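(* Let $\|\cdot\|$ be a norm on $\mathbb{R}^2$ with closed unit ball $B=\{x\in\mathbb{R}^2:\|x\|\le 1\}$. Let $n\ge 3$ be an odd integer and let $v_1,v_2,\ldots,v_n\in B$ be vectors, not necessarily distinct. If $\|v_i+v_j+v_k\|>1$ for all pairwise distinct indices $i,j,k\in\{1,\ldots,n\}$, then $$\|v_1+v_2+\cdots+v_n\|>1.$$
   Context: The norm $\|\cdot\|$ on $\mathbb{R}^2$ is arbitrary (not necessarily Euclidean or strictly convex). The family $v_1,\ldots,v_n$ is regarded as a sequence (multiset): $v_i=v_j$ is allowed for $i\ne j$. *)

theory Defs
  imports "HOL-Analysis.Analysis"
begin

(* A norm is a function rather than the type class operation norm, because the latter
   is fixed to the Euclidean norm on real ^ 2. *)
definition is_norm :: "('a::real_vector \<Rightarrow> real) \<Rightarrow> bool" where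
  "is_norm N \<longleftrightarrow>
     (\<forall>x. 0 \<le> N x) \<and>
     (\<forall>x. N x = 0 \<longleftrightarrow> x = 0) \<and>
     (\<forall>c x. N (c *\<^sub>R x) = \<bar>c\<bar> * N x) \<and>
     (\<forall>x y. N (x + y) \<le> N x + N y)"

definition unit_ball :: "('a::real_vector \<Rightarrow> real) \<Rightarrow> 'a set" where
  "unit_ball N = {x. N x \<le> 1}"

lemma is_norm_norm: "is_norm (norm :: 'a::real_normed_vector \<Rightarrow> real)"
  by (simp add: is_norm_def norm_triangle_ineq)

end

theory Submission
  imports Defs
begin

text \<open>
  Call a subset sum short if its norm is at most 1. The proof is by induction on the odd number
  \<open>n\<close>, the case \<open>n = 3\<close> being the hypothesis. Let \<open>n \<ge> 5\<close> and suppose that the total \<open>s\<close> is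
  short. Adjoin the vector \<open>- s\<close>: this gives \<open>n + 1\<close> vectors of the unit ball with sum zero, so
  complementary subfamilies have opposite sums. Among any vectors of the ball with sum zero
  there are three with a short sum (a case of \<open>rounding_weights\<close>, see below). If these three do not
  include \<open>- s\<close>, the hypothesis is violated; if they do, the complement consists of \<open>n - 2\<close> of
  the original vectors, has a short sum and so contradicts the induction hypothesis. Parity enters
  because \<open>n - 2\<close> is again odd.

  To find three vectors with a short sum, give each vector the weight \<open>3 / (n + 1)\<close>; the weighted
  sum is zero. Moving along affine dependences keeps the weights in \<open>[0, 1]\<close> and preserves both
  their total and the weighted sum, and makes all but at most three weights integral, because four
  points of the plane are affinely dependent. The remaining weights, if any, add up to 1 or 2. In the first
  case they express a point \<open>p\<close> as a convex combination of points of the ball, and rounding a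
  single one of them up to 1 moves the sum by the difference between \<open>p\<close> and that point; in the
  second case the same holds for the complementary weights. So what is needed is that a convex
  combination of points of the ball is within distance 1 of one of these points, which is the
  planar lemma \<open>convex_combination_near_point\<close>.
\<close>

section \<open>Convex combinations of points of the unit ball of a plane\<close>

lemma norm_convex_le_one:
  fixes N :: "'a::real_vector \<Rightarrow> real"
  assumes N: "is_norm N" and x: "N x \<le> 1" and y: "N y \<le> 1" and t: "0 \<le> t" "t \<le> 1"
  shows "N ((1 - t) *\<^sub>R x + t *\<^sub>R y) \<le> 1"
proof -
  have "N ((1 - t) *\<^sub>R x + t *\<^sub>R y) \<le> (1 - t) * N x + t * N y"
    using N t unfolding is_norm_def by (smt (verit, best))
  also have "\<dots> \<le> (1 - t) * 1 + t * 1"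
    using x y t by (intro add_mono mult_left_mono) auto
  finally show ?thesis by simp
qed

lemma is_norm_minus:
  assumes "is_norm N"
  shows "N (- x) = N x"
proof -
  have "N ((-1) *\<^sub>R x) = \<bar>-1\<bar> * N x"
    using assms unfolding is_norm_def by blast
  then show ?thesis by simp
qed

lemma parallel_in_plane:
  fixes p x :: "real ^ 2"
  assumes "p \<noteq> 0" and "p $ 1 * x $ 2 - p $ 2 * x $ 1 = 0"
  shows "x = ((x \<bullet> p) / (p \<bullet> p)) *\<^sub>R p"
proof -
  have "(p \<bullet> p) *\<^sub>R x = (x \<bullet> p) *\<^sub>R p"
    using assms(2) by (simp add: vec_eq_iff forall_2 inner_vec_def sum_2) algebra
  then have "(1 / (p \<bullet> p)) *\<^sub>R ((p \<bullet> p) *\<^sub>R x) = (1 / (p \<bullet> p)) *\<^sub>R ((x \<bullet> p) *\<^sub>R p)"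
    by simp
  then show ?thesis using assms(1) by simp
qed

text \<open>
  Let \<open>p\<close> be the convex combination and \<open>z\<close> the one of the points that is farthest from the line
  through 0 and \<open>p\<close>. Every point is then \<open>\<alpha> z + \<beta> p\<close> with \<open>\<bar>\<alpha>\<bar> \<le> 1\<close>. If \<open>\<beta> \<ge> 1\<close>, then
  \<open>\<alpha> z + (\<beta> - 1) p\<close> lies on the segment between \<open>\<alpha> z\<close> and \<open>\<alpha> z + \<beta> p\<close>, hence in the ball. As the
  weighted mean of the \<open>\<beta>\<close> is 1, some point has \<open>\<beta> \<ge> 1\<close>.
\<close>

lemma convex_combination_near_point:
  fixes N :: "real ^ 2 \<Rightarrow> real" and a :: "'i \<Rightarrow> real ^ 2"
  assumes N: "is_norm N" and fin: "finite F"
    and a: "\<And>i. i \<in> F \<Longrightarrow> N (a i) \<le> 1"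
    and l0: "\<And>i. i \<in> F \<Longrightarrow> 0 \<le> l i" and l1: "sum l F = 1"
  shows "\<exists>i\<in>F. N (a i - (\<Sum>j\<in>F. l j *\<^sub>R a j)) \<le> 1"
proof -
  define p where "p = (\<Sum>j\<in>F. l j *\<^sub>R a j)"
  have ne: "F \<noteq> {}" using l1 by auto
  show ?thesis
  proof (cases "p = 0")
    case True
    then show ?thesis using a ne unfolding p_def[symmetric] by auto
  next
    case p0: False
    define \<phi> where "\<phi> x = p $ 1 * x $ 2 - p $ 2 * x $ 1" for x :: "real ^ 2"
    have lin: "linear \<phi>"
      unfolding \<phi>_def by (rule linearI) (auto simp: algebra_simps)
    have \<phi>p: "\<phi> p = 0" by (simp add: \<phi>_def)
    obtain m where m: "m \<in> F" and mmax: "\<And>i. i \<in> F \<Longrightarrow> \<bar>\<phi> (a i)\<bar> \<le> \<bar>\<phi> (a m)\<bar>"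
    proof -
      have "Max ((\<lambda>i. \<bar>\<phi> (a i)\<bar>) ` F) \<in> (\<lambda>i. \<bar>\<phi> (a i)\<bar>) ` F"
        using fin ne by (intro Max_in) auto
      then obtain m where "m \<in> F" "\<bar>\<phi> (a m)\<bar> = Max ((\<lambda>i. \<bar>\<phi> (a i)\<bar>) ` F)" by auto
      with fin show ?thesis by (intro that[of m]) auto
    qed
    define z where "z = a m"
    \<comment> \<open>If all points lie on the line through \<open>p\<close>, then \<open>\<phi> z = 0\<close> and division by zero yields
      the correct value \<open>\<alpha> i = 0\<close>.\<close>
    define \<alpha> where "\<alpha> i = \<phi> (a i) / \<phi> z" for i
    define \<beta> where "\<beta> i = ((a i - \<alpha> i *\<^sub>R z) \<bullet> p) / (p \<bullet> p)" for i
    have \<alpha>: "\<bar>\<alpha> i\<bar> \<le> 1" if "i \<in> F" for i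
      using mmax[OF that] by (auto simp: \<alpha>_def z_def divide_le_eq_1)
    have dec: "a i = \<alpha> i *\<^sub>R z + \<beta> i *\<^sub>R p" if "i \<in> F" for i
    proof -
      have "\<phi> (a i - \<alpha> i *\<^sub>R z) = \<phi> (a i) - \<alpha> i * \<phi> z"
        using lin by (simp add: linear_diff linear_cmul)
      also have "\<dots> = 0"
        using mmax[OF that] by (auto simp: \<alpha>_def z_def)
      finally have "a i - \<alpha> i *\<^sub>R z = \<beta> i *\<^sub>R p"
        unfolding \<beta>_def using parallel_in_plane[OF p0] by (simp add: \<phi>_def)
      then show ?thesis by (simp add: algebra_simps)
    qed
    have "(\<Sum>i\<in>F. l i * \<phi> (a i)) = 0"
    proof -
      have "(\<Sum>i\<in>F. l i * \<phi> (a i)) = \<phi> p"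
        unfolding p_def using lin by (simp add: linear_sum linear_cmul)
      with \<phi>p show ?thesis by simp
    qed
    then have \<alpha>sum: "(\<Sum>i\<in>F. l i * \<alpha> i) = 0"
      by (simp add: \<alpha>_def flip: sum_divide_distrib)
    have "p = (\<Sum>i\<in>F. l i *\<^sub>R (\<alpha> i *\<^sub>R z + \<beta> i *\<^sub>R p))"
      using dec by (subst p_def) (rule sum.cong, simp_all)
    also have "\<dots> = (\<Sum>i\<in>F. l i * \<alpha> i) *\<^sub>R z + (\<Sum>i\<in>F. l i * \<beta> i) *\<^sub>R p"
      by (simp add: scaleR_add_right sum.distrib scaleR_sum_left)
    finally have "(1 - (\<Sum>i\<in>F. l i * \<beta> i)) *\<^sub>R p = 0"
      using \<alpha>sum by (simp add: algebra_simps)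
    then have \<beta>sum: "(\<Sum>i\<in>F. l i * \<beta> i) = 1" using p0 by simp
    have "\<exists>i\<in>F. \<beta> i \<ge> 1"
    proof (rule ccontr)
      assume "\<not> (\<exists>i\<in>F. \<beta> i \<ge> 1)"
      then have lt: "\<beta> i < 1" if "i \<in> F" for i using that by force
      have "(\<Sum>i\<in>F. l i * (1 - \<beta> i)) = 0"
        using l1 \<beta>sum by (simp add: algebra_simps sum_subtractf)
      moreover have "0 \<le> l i * (1 - \<beta> i)" if "i \<in> F" for i
        using l0[OF that] lt[OF that] by simp
      ultimately have "\<forall>i\<in>F. l i * (1 - \<beta> i) = 0"
        using sum_nonneg_eq_0_iff[OF fin, of "\<lambda>i. l i * (1 - \<beta> i)"] by blast
      then have "\<forall>i\<in>F. l i = 0" using lt by fastforce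
      then show False using l1 by simp
    qed
    then obtain i where i: "i \<in> F" and b: "\<beta> i \<ge> 1" by blast
    have "N (\<alpha> i *\<^sub>R z) \<le> 1"
    proof -
      have "N (\<alpha> i *\<^sub>R z) = \<bar>\<alpha> i\<bar> * N z" using N unfolding is_norm_def by blast
      also have "\<dots> \<le> 1 * 1"
        using \<alpha>[OF i] a[OF m] N unfolding z_def is_norm_def by (intro mult_mono) auto
      finally show ?thesis by simp
    qed
    then have "N ((1 - (\<beta> i - 1) / \<beta> i) *\<^sub>R (\<alpha> i *\<^sub>R z) + ((\<beta> i - 1) / \<beta> i) *\<^sub>R a i) \<le> 1"
      using a[OF i] b by (intro norm_convex_le_one[OF N]) (auto simp: divide_simps)
    also have "(1 - (\<beta> i - 1) / \<beta> i) *\<^sub>R (\<alpha> i *\<^sub>R z) + ((\<beta> i - 1) / \<beta> i) *\<^sub>R a i = a i - p"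
    proof -
      have "a i - p = \<alpha> i *\<^sub>R z + (\<beta> i - 1) *\<^sub>R p"
        using dec[OF i] by (simp add: algebra_simps)
      moreover have "((\<beta> i - 1) / \<beta> i) *\<^sub>R a i
          = ((\<beta> i - 1) / \<beta> i) *\<^sub>R (\<alpha> i *\<^sub>R z) + (\<beta> i - 1) *\<^sub>R p"
        using b by (subst dec[OF i]) (simp add: scaleR_add_right)
      ultimately show ?thesis by (simp add: algebra_simps)
    qed
    finally show ?thesis using i unfolding p_def by blast
  qed
qed

section \<open>Making weights integral\<close>

lemma indexed_affine_dependence:
  fixes u :: "'i \<Rightarrow> 'a::euclidean_space"
  assumes fin: "finite F" and card: "card F \<ge> DIM('a) + 2"
  shows "\<exists>d. (\<Sum>i\<in>F. d i) = 0 \<and> (\<Sum>i\<in>F. d i *\<^sub>R u i) = 0 \<and> (\<exists>i\<in>F. d i \<noteq> (0::real))"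
proof (cases "inj_on u F")
  case True
  then have "card (u ` F) \<ge> DIM('a) + 2" using card by (simp add: card_image)
  then have "affine_dependent (u ` F)"
    using fin by (intro affine_dependent_biggerset) auto
  then obtain c where c: "sum c (u ` F) = 0" "\<exists>x\<in>u ` F. c x \<noteq> 0" "(\<Sum>x\<in>u ` F. c x *\<^sub>R x) = 0"
    using affine_dependent_explicit_finite[of "u ` F"] fin by auto
  then show ?thesis
    using True by (intro exI[of _ "c \<circ> u"]) (auto simp: sum.reindex)
next
  case False
  then obtain i j where ij: "i \<in> F" "j \<in> F" "i \<noteq> j" "u i = u j" by (auto simp: inj_on_def)
  define d where "d k = (if k = i then 1 else 0) - (if k = j then 1 else (0::real))" for k
  have "(\<Sum>k\<in>F. d k) = 0"
    using ij fin by (simp add: d_def sum_subtractf)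
  moreover have "(\<Sum>k\<in>F. d k *\<^sub>R u k) = 0"
  proof -
    have "(\<Sum>k\<in>F. d k *\<^sub>R u k)
        = (\<Sum>k\<in>F. (if k = i then u k else 0) - (if k = j then u k else 0))"
      by (intro sum.cong) (auto simp: d_def)
    also have "\<dots> = 0" using ij fin by (simp add: sum_subtractf)
    finally show ?thesis .
  qed
  moreover have "d i \<noteq> 0" using ij by (simp add: d_def)
  ultimately show ?thesis using ij by blast
qed

text \<open>
  Walking from \<open>l\<close> in direction \<open>d\<close>, the first coordinate that leaves the open unit interval does
  so after time \<open>t\<close>, the least of the individual exit times; stopping there makes it integral.
\<close>

lemma walk_to_boundary:
  fixes l d :: "'i \<Rightarrow> real"
  assumes fin: "finite F" and l: "\<And>i. i \<in> F \<Longrightarrow> 0 < l i \<and> l i < 1"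
    and d: "\<exists>i\<in>F. d i \<noteq> 0"
  shows "\<exists>t. (\<forall>i\<in>F. 0 \<le> l i + t * d i \<and> l i + t * d i \<le> 1) \<and>
             (\<exists>i\<in>F. l i + t * d i \<in> {0, 1})"
proof -
  define e where "e i = (if d i > 0 then (1 - l i) / d i else - l i / d i)" for i
  define S where "S = {i \<in> F. d i \<noteq> 0}"
  have S: "finite S" "S \<noteq> {}" using fin d by (auto simp: S_def)
  define t where "t = Min (e ` S)"
  have "t \<in> e ` S" unfolding t_def using S by (intro Min_in) auto
  then obtain m where m: "m \<in> S" "t = e m" by auto
  have tle: "t \<le> e i" if "i \<in> S" for i unfolding t_def using S that by simp
  have t0: "0 \<le> t"
    using m l[of m] by (auto simp: S_def e_def divide_nonneg_nonpos)
  have "l m + t * d m \<in> {0, 1}" using m by (auto simp: e_def S_def)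
  moreover have "0 \<le> l i + t * d i \<and> l i + t * d i \<le> 1" if i: "i \<in> F" for i
  proof -
    consider "d i = 0" | "d i > 0" | "d i < 0" by linarith
    then show ?thesis
    proof cases
      case 1
      then show ?thesis using l[OF i] by simp
    next
      case 2
      then have "t \<le> (1 - l i) / d i" using tle[of i] i by (simp add: S_def e_def)
      then have "t * d i \<le> 1 - l i" using 2 by (simp add: pos_le_divide_eq)
      moreover have "0 \<le> t * d i" using 2 t0 by simp
      ultimately show ?thesis using l[OF i] by linarith
    next
      case 3
      then have "t \<le> - l i / d i" using tle[of i] i by (simp add: S_def e_def)
      then have "t * d i \<ge> - l i" using 3 neg_le_divide_eq by blast
      moreover have "t * d i \<le> 0" using 3 t0 by (simp add: mult_nonneg_nonpos)
      ultimately show ?thesis using l[OF i] by linarith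
    qed
  qed
  ultimately show ?thesis using m by (auto simp: S_def)
qed

text \<open>
  The weights with prescribed total and prescribed weighted sum form a polytope in a cube, cut out
  by \<open>DIM('a) + 1\<close> linear equations; a vertex of it has at most that many coordinates strictly
  between 0 and 1. Walking along an affine dependence of the vectors with fractional weights reduces
  the number of those weights as long as there are more.
\<close>

lemma few_fractional_weights:
  fixes u :: "'i \<Rightarrow> 'a::euclidean_space" and l :: "'i \<Rightarrow> real"
  assumes fin: "finite I" and l: "\<And>i. i \<in> I \<Longrightarrow> 0 \<le> l i \<and> l i \<le> 1"
  shows "\<exists>\<mu>. (\<forall>i\<in>I. 0 \<le> \<mu> i \<and> \<mu> i \<le> 1) \<and> sum \<mu> I = sum l I \<and>
             (\<Sum>i\<in>I. \<mu> i *\<^sub>R u i) = (\<Sum>i\<in>I. l i *\<^sub>R u i) \<and>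
             card {i \<in> I. 0 < \<mu> i \<and> \<mu> i < 1} \<le> DIM('a) + 1"
  using l
proof (induction "card {i \<in> I. 0 < l i \<and> l i < 1}" arbitrary: l rule: less_induct)
  case less
  define F where "F = {i \<in> I. 0 < l i \<and> l i < 1}"
  show ?case
  proof (cases "card F \<le> DIM('a) + 1")
    case True
    then show ?thesis using less.prems unfolding F_def by (intro exI[of _ l]) auto
  next
    case False
    have finF: "finite F" using fin by (simp add: F_def)
    obtain d where d: "(\<Sum>i\<in>F. d i) = 0" "(\<Sum>i\<in>F. d i *\<^sub>R u i) = 0" "\<exists>i\<in>F. d i \<noteq> 0"
      using indexed_affine_dependence[OF finF, of u] False by auto
    obtain t where t: "\<And>i. i \<in> F \<Longrightarrow> 0 \<le> l i + t * d i \<and> l i + t * d i \<le> 1"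
      and hit: "\<exists>i\<in>F. l i + t * d i \<in> {0, 1}"
      using walk_to_boundary[OF finF _ d(3), of l] by (auto simp: F_def)
    define l' where "l' i = l i + (if i \<in> F then t * d i else 0)" for i
    have bounds: "0 \<le> l' i \<and> l' i \<le> 1" if "i \<in> I" for i
      using t[of i] less.prems[OF that] by (auto simp: l'_def)
    have restrict: "{i \<in> I. i \<in> F} = F" by (auto simp: F_def)
    have total: "sum l' I = sum l I"
    proof -
      have "sum l' I = sum l I + (\<Sum>i\<in>F. t * d i)"
        using fin by (simp add: l'_def sum.distrib restrict flip: sum.inter_filter)
      then show ?thesis using d(1) by (simp flip: sum_distrib_left)
    qed
    have wsum: "(\<Sum>i\<in>I. l' i *\<^sub>R u i) = (\<Sum>i\<in>I. l i *\<^sub>R u i)"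
    proof -
      have "(\<Sum>i\<in>I. l' i *\<^sub>R u i)
          = (\<Sum>i\<in>I. l i *\<^sub>R u i + (if i \<in> F then t *\<^sub>R (d i *\<^sub>R u i) else 0))"
        by (intro sum.cong) (auto simp: l'_def algebra_simps)
      also have "\<dots> = (\<Sum>i\<in>I. l i *\<^sub>R u i) + (\<Sum>i\<in>F. t *\<^sub>R (d i *\<^sub>R u i))"
        using fin by (simp add: sum.distrib restrict flip: sum.inter_filter)
      also have "(\<Sum>i\<in>F. t *\<^sub>R (d i *\<^sub>R u i)) = 0"
        using d(2) by (simp only: flip: scaleR_sum_right) simp
      finally show ?thesis by simp
    qed
    have "{i \<in> I. 0 < l' i \<and> l' i < 1} \<subset> F"
    proof -
      have "{i \<in> I. 0 < l' i \<and> l' i < 1} \<subseteq> F"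
        using less.prems by (auto simp: l'_def F_def split: if_splits)
      moreover obtain m where "m \<in> F" "l' m \<in> {0, 1}" using hit by (auto simp: l'_def)
      ultimately show ?thesis by auto
    qed
    then have "card {i \<in> I. 0 < l' i \<and> l' i < 1} < card {i \<in> I. 0 < l i \<and> l i < 1}"
      using finF unfolding F_def by (intro psubset_card_mono) auto
    from less.hyps[OF this] bounds total wsum show ?thesis by force
  qed
qed

lemma sum_one_and_fractional_weights:
  fixes g :: "'i \<Rightarrow> 'b::comm_monoid_add" and \<mu> :: "'i \<Rightarrow> real"
  assumes "finite I" and "\<And>i. i \<in> I \<Longrightarrow> 0 \<le> \<mu> i \<and> \<mu> i \<le> 1"
    and "\<And>i. i \<in> I \<Longrightarrow> \<mu> i = 0 \<Longrightarrow> g i = 0"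
  shows "(\<Sum>i\<in>I. g i) =
    (\<Sum>i | i \<in> I \<and> \<mu> i = 1. g i) + (\<Sum>i | i \<in> I \<and> 0 < \<mu> i \<and> \<mu> i < 1. g i)"
proof -
  have "(\<Sum>i\<in>I. g i) = (\<Sum>i\<in>{i \<in> I. \<mu> i = 1} \<union> {i \<in> I. 0 < \<mu> i \<and> \<mu> i < 1}. g i)"
    using assms by (intro sum.mono_neutral_right) force+
  then show ?thesis using assms(1) by (subst (asm) sum.union_disjoint) auto
qed

text \<open>
  After reduction to at most three fractional weights, their total is an integer smaller than their
  number. A total of 1 allows one of these indices to be selected; a total of 2 forces exactly three
  of them, and one is omitted.
\<close>

lemma rounding_weights:
  fixes N :: "real ^ 2 \<Rightarrow> real" and u :: "'i \<Rightarrow> real ^ 2"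
  assumes N: "is_norm N" and fin: "finite I"
    and u: "\<And>i. i \<in> I \<Longrightarrow> N (u i) \<le> 1"
    and l: "\<And>i. i \<in> I \<Longrightarrow> 0 \<le> l i \<and> l i \<le> 1" and k: "sum l I = real k"
  shows "\<exists>T\<subseteq>I. card T = k \<and> N ((\<Sum>i\<in>T. u i) - (\<Sum>i\<in>I. l i *\<^sub>R u i)) \<le> 1"
proof -
  obtain \<mu> where \<mu>: "\<And>i. i \<in> I \<Longrightarrow> 0 \<le> \<mu> i \<and> \<mu> i \<le> 1" and \<mu>k: "sum \<mu> I = real k"
    and \<mu>u: "(\<Sum>i\<in>I. \<mu> i *\<^sub>R u i) = (\<Sum>i\<in>I. l i *\<^sub>R u i)"
    and few: "card {i \<in> I. 0 < \<mu> i \<and> \<mu> i < 1} \<le> 3"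
    using few_fractional_weights[where u = u and l = l, OF fin l] k by auto
  define F where "F = {i \<in> I. 0 < \<mu> i \<and> \<mu> i < 1}"
  define A where "A = {i \<in> I. \<mu> i = 1}"
  define w where "w = (\<Sum>i\<in>I. l i *\<^sub>R u i)"
  have sets: "finite F" "finite A" "F \<subseteq> I" "A \<subseteq> I" "A \<inter> F = {}" "card F \<le> 3"
    using fin few by (auto simp: F_def A_def)
  have "real k = real (card A) + sum \<mu> F"
    using sum_one_and_fractional_weights[where \<mu> = \<mu> and g = \<mu>, OF fin \<mu>] \<mu>k
    by (simp add: A_def F_def)
  moreover have "0 \<le> sum \<mu> F" by (intro sum_nonneg) (simp add: F_def)
  ultimately obtain j where j: "k = card A + j" "sum \<mu> F = real j"
    by (metis le_add_same_cancel1 nat_le_iff_add of_nat_add of_nat_le_iff add_left_imp_eq)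
  have w: "w = (\<Sum>i\<in>A. u i) + (\<Sum>i\<in>F. \<mu> i *\<^sub>R u i)"
  proof -
    have "w = (\<Sum>i\<in>A. \<mu> i *\<^sub>R u i) + (\<Sum>i\<in>F. \<mu> i *\<^sub>R u i)"
      unfolding w_def \<mu>u[symmetric] A_def F_def
      by (rule sum_one_and_fractional_weights[where \<mu> = \<mu>, OF fin \<mu>]) auto
    then show ?thesis by (simp add: A_def)
  qed
  show ?thesis
  proof (cases "F = {}")
    case True
    then have "j = 0" using j by simp
    have "N 0 = 0" using N unfolding is_norm_def by blast
    then have "N ((\<Sum>i\<in>A. u i) - w) \<le> 1"
      using True w by simp
    then show ?thesis using sets j \<open>j = 0\<close> unfolding w_def by (intro exI[of _ A]) auto
  next
    case False
    have pos: "0 < sum \<mu> F" using sets False by (intro sum_pos) (auto simp: F_def)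
    have "sum \<mu> F < (\<Sum>i\<in>F. 1)"
      using sets False by (intro sum_strict_mono) (auto simp: F_def)
    then have "j < card F" using j by simp
    moreover have "0 < j" using pos j by simp
    ultimately consider "j = 1" | "j = 2" "card F = 3" using sets(6) by linarith
    then show ?thesis
    proof cases
      case 1
      obtain c where c: "c \<in> F" "N (u c - (\<Sum>i\<in>F. \<mu> i *\<^sub>R u i)) \<le> 1"
        using convex_combination_near_point[OF N sets(1), where a = u and l = \<mu>] u j 1 by (auto simp: F_def)
      have "c \<notin> A" using c sets by auto
      then have "(\<Sum>i\<in>insert c A. u i) - w = u c - (\<Sum>i\<in>F. \<mu> i *\<^sub>R u i)"
        using sets w by simp
      then have "N ((\<Sum>i\<in>insert c A. u i) - w) \<le> 1" using c(2) by metis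
      moreover have "insert c A \<subseteq> I" "card (insert c A) = k"
        using c \<open>c \<notin> A\<close> sets j 1 by auto
      ultimately show ?thesis unfolding w_def by blast
    next
      case 2
      define \<nu> where "\<nu> i = 1 - \<mu> i" for i
      have "sum \<nu> F = 1" using 2 j by (simp add: \<nu>_def sum_subtractf)
      then obtain c where c: "c \<in> F" "N (u c - (\<Sum>i\<in>F. \<nu> i *\<^sub>R u i)) \<le> 1"
        using convex_combination_near_point[OF N sets(1), where a = u and l = \<nu>] u by (auto simp: F_def \<nu>_def)
      let ?T = "A \<union> (F - {c})"
      have "(\<Sum>i\<in>?T. u i) = (\<Sum>i\<in>A. u i) + ((\<Sum>i\<in>F. u i) - u c)"
        using sets c by (subst sum.union_disjoint) (auto simp: sum_diff1)
      moreover have "(\<Sum>i\<in>F. \<nu> i *\<^sub>R u i) = (\<Sum>i\<in>F. u i) - (\<Sum>i\<in>F. \<mu> i *\<^sub>R u i)"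
        by (simp add: \<nu>_def algebra_simps sum_subtractf)
      ultimately have "(\<Sum>i\<in>?T. u i) - w = - (u c - (\<Sum>i\<in>F. \<nu> i *\<^sub>R u i))"
        using w by simp
      then have "N ((\<Sum>i\<in>?T. u i) - w) \<le> 1"
        using c(2) is_norm_minus[OF N] by metis
      moreover have "card ?T = k"
        using sets c j 2 by (subst card_Un_disjoint) auto
      moreover have "?T \<subseteq> I" using sets by auto
      ultimately show ?thesis unfolding w_def by blast
    qed
  qed
qed

section \<open>Triples with a short sum\<close>

lemma sum_gt_one_of_triples:
  fixes N :: "real ^ 2 \<Rightarrow> real" and v :: "'i \<Rightarrow> real ^ 2"
  assumes N: "is_norm N" and "finite I" and "odd (card I)" and "card I \<ge> 3"
    and "\<And>i. i \<in> I \<Longrightarrow> N (v i) \<le> 1"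
    and "\<And>T. T \<subseteq> I \<Longrightarrow> card T = 3 \<Longrightarrow> N (\<Sum>i\<in>T. v i) > 1"
  shows "N (\<Sum>i\<in>I. v i) > 1"
  using assms(2-)
proof (induction "card I" arbitrary: I rule: less_induct)
  case less
  note fin = \<open>finite I\<close> and ball = less.prems(4) and triples = less.prems(5)
  show ?case
  proof (cases "card I = 3")
    case True
    then show ?thesis using triples by blast
  next
    case False
    then have card5: "card I \<ge> 5" using less.prems(2,3) by presburger
    show ?thesis
    proof (rule ccontr)
      define s where "s = (\<Sum>i\<in>I. v i)"
      assume "\<not> N (\<Sum>i\<in>I. v i) > 1"
      then have s: "N s \<le> 1" by (simp add: s_def)
      \<comment> \<open>The additional index \<open>None\<close> carries the vector \<open>- s\<close>.\<close>
      define J where "J = insert None (Some ` I)"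
      define u where "u x = (case x of None \<Rightarrow> - s | Some i \<Rightarrow> v i)" for x
      have finJ: "finite J" and cardJ: "card J = card I + 1"
        using fin by (auto simp: J_def card_image)
      have u1: "N (u x) \<le> 1" if "x \<in> J" for x
        using that s ball is_norm_minus[OF N] by (auto simp: u_def J_def)
      have uSome: "(\<Sum>x\<in>Some ` S. u x) = (\<Sum>i\<in>S. v i)" for S
        by (simp add: sum.reindex u_def)
      have usum: "(\<Sum>x\<in>J. u x) = 0"
        using fin by (simp add: J_def uSome) (simp add: u_def s_def)
      define l where "l x = 3 / real (card J)" for x :: "'i option"
      have "\<exists>T\<subseteq>J. card T = 3 \<and> N ((\<Sum>x\<in>T. u x) - (\<Sum>x\<in>J. l x *\<^sub>R u x)) \<le> 1"
        using cardJ card5 u1 by (intro rounding_weights[OF N finJ]) (auto simp: l_def field_simps)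
      moreover have "(\<Sum>x\<in>J. l x *\<^sub>R u x) = 0"
        using usum by (simp add: l_def flip: scaleR_sum_right)
      ultimately obtain T where T: "T \<subseteq> J" "card T = 3" "N (\<Sum>x\<in>T. u x) \<le> 1" by auto
      define S where "S = {i. Some i \<in> T}"
      have SI: "S \<subseteq> I" using T(1) by (auto simp: S_def J_def)
      have finS: "finite S" using SI fin finite_subset by blast
      show False
      proof (cases "None \<in> T")
        case False
        have TS: "T = Some ` S"
        proof (rule set_eqI)
          show "x \<in> T \<longleftrightarrow> x \<in> Some ` S" for x using False by (cases x) (auto simp: S_def)
        qed
        then have "card S = 3" using T(2) by (simp add: card_image)
        then show False using triples[OF SI] T(3) by (simp add: TS uSome)
      next
        case True
        have TS: "T = insert None (Some ` S)"
        proof (rule set_eqI)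
          show "x \<in> T \<longleftrightarrow> x \<in> insert None (Some ` S)" for x
            using True by (cases x) (auto simp: S_def)
        qed
        then have "card S = 2" using T(2) finS by (simp add: card_image)
        then have cardC: "card (I - S) = card I - 2"
          using SI finS by (simp add: card_Diff_subset)
        have "(\<Sum>x\<in>T. u x) = - s + (\<Sum>i\<in>S. v i)"
          using finS by (simp add: TS uSome) (simp add: u_def)
        also have "\<dots> = - (\<Sum>i\<in>I - S. v i)"
          using SI fin by (simp add: s_def sum_diff)
        finally have "N (\<Sum>i\<in>I - S. v i) \<le> 1" using T(3) is_norm_minus[OF N] by simp
        moreover have "N (\<Sum>i\<in>I - S. v i) > 1"
        proof (rule less.hyps)
          show "card (I - S) < card I" "card (I - S) \<ge> 3" "odd (card (I - S))"
            using cardC card5 less.prems(2) by auto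
        qed (use fin ball triples in auto)
        ultimately show False by simp
      qed
    qed
  qed
qed

theorem theorem3:
  fixes N :: "real ^ 2 \<Rightarrow> real" and n :: nat and v :: "nat \<Rightarrow> real ^ 2"
  assumes "is_norm N"
    and "n \<ge> 3" and "odd n"
    and "\<forall>i\<in>{1..n}. v i \<in> unit_ball N"
    and "\<forall>i\<in>{1..n}. \<forall>j\<in>{1..n}. \<forall>k\<in>{1..n}.
           i \<noteq> j \<and> j \<noteq> k \<and> i \<noteq> k \<longrightarrow> N (v i + v j + v k) > 1"
  shows "N (\<Sum>i\<in>{1..n}. v i) > 1"
proof (rule sum_gt_one_of_triples[OF assms(1)])
  fix T assume T: "T \<subseteq> {1..n}" "card T = 3"
  then obtain i j k where ijk: "T = {i, j, k}" "i \<noteq> j" "j \<noteq> k" "i \<noteq> k"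
    by (auto simp: card_3_iff)
  then have "(\<Sum>i\<in>T. v i) = v i + v j + v k" by (simp add: add.assoc)
  moreover have "N (v i + v j + v k) > 1" using assms(5) T(1) ijk by blast
  ultimately show "N (\<Sum>i\<in>T. v i) > 1" by simp
qed (use assms in \<open>auto simp: unit_ball_def\<close>)

end
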